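(* Let $L>0$ and suppose that $F:\mathbb{R}^d\rightarrow\mathbb{R}$ is (possibly non-convex) $L$-smooth. Let $T\in\{1,\ldots,d\}$. Then for any $x,x^+\in\mathbb{R}^d$ with $x^+=x-\gamma Q_T(\nabla F(x))$, where $Q_T$ is the sparsification-plus-quantization operator and $\gamma=\sqrt{\beta(T)}/(\sqrt{T}L)$, we have $$F(x^+)\leq F(x)-\frac{\beta(T)}{2L}\|\nabla F(x)\|^2,\qquad\text{where}\qquad \beta(T)=\frac{1}{T}\frac{\langle\nabla F(x),Q_T(\nabla F(x))\rangle^2}{\|\nabla F(x)\|_2^4}.$$
   Context: $\|\cdot\|=\|\cdot\|_2$ is the Euclidean norm. A continuously differentiable $F:\mathbb{R}^d\to\mathbb{R}$ is $L$-smooth if $\|\nabla F(x)-\nabla F(y)\|\le L\|x-y\|$ for all $x,y\in\mathbb{R}^d$. For $g\in\mathbb{R}^d$, $I_T(g)$ is the index set of the $T$ components of $g$ with largest magnitude (ties broken by any fixed rule). The sparsification-plus-quantization operator is $[Q_T(g)]_j=\|g\|\,\mathrm{sign}(g_j)$ if $j\in I_T(g)$ and $[Q_T(g)]_j=0$ otherwise. The ratio $\beta(T)$ (which depends on $x$) is understood at points with $\nabla F(x)\ne 0$. *)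

theory Defs
  imports "HOL-Analysis.Analysis"
begin

(* The underlying vector is unique where F is differentiable (gderiv_gradient below);
   elsewhere the value is unspecified. *)
definition gradient :: "('a::euclidean_space \<Rightarrow> real) \<Rightarrow> 'a \<Rightarrow> 'a" where
  "gradient F x = (THE D. GDERIV F x :> D)"

lemma gderiv_gradient:
  fixes F :: "'a::euclidean_space \<Rightarrow> real"
  assumes "F differentiable (at x)"
  shows "GDERIV F x :> gradient F x"
proof -
  obtain F' where F': "(F has_derivative F') (at x)"
    using assms by (auto simp: differentiable_def)
  then interpret F': bounded_linear F' by (rule has_derivative_bounded_linear)
  define D where "D = (\<Sum>b\<in>Basis. F' b *\<^sub>R b)"
  have "F' h = h \<bullet> D" for h
  proof -
    have "F' h = F' (\<Sum>b\<in>Basis. (h \<bullet> b) *\<^sub>R b)" by (simp add: euclidean_representation)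
    also have "\<dots> = h \<bullet> D"
      by (simp add: F'.sum F'.scaleR D_def inner_sum_right mult.commute)
    finally show ?thesis .
  qed
  then have "F' = (\<lambda>h. h \<bullet> D)" by auto
  with F' have D: "GDERIV F x :> D" by (simp add: gderiv_def)
  have "E = D" if "GDERIV F x :> E" for E
  proof -
    have "(\<lambda>h. h \<bullet> E) = (\<lambda>h. h \<bullet> D)"
      using that D unfolding gderiv_def by (rule has_derivative_unique)
    then have "(E - D) \<bullet> E = (E - D) \<bullet> D" by (rule fun_cong)
    then have "(E - D) \<bullet> (E - D) = 0" by (simp add: inner_diff_right)
    then show ?thesis by simp
  qed
  with D show ?thesis unfolding gradient_def by (rule theI)
qed

definition L_smooth :: "real \<Rightarrow> ('a::euclidean_space \<Rightarrow> real) \<Rightarrow> bool" where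
  "L_smooth L F \<longleftrightarrow>
     (\<forall>x. F differentiable (at x)) \<and> continuous_on UNIV (gradient F) \<and>
     (\<forall>x y. norm (gradient F x - gradient F y) \<le> L * norm (x - y))"

definition largest_components :: "nat \<Rightarrow> real ^ 'n \<Rightarrow> 'n set \<Rightarrow> bool" where
  "largest_components T g S \<longleftrightarrow>
     card S = T \<and> (\<forall>i\<in>S. \<forall>j. j \<notin> S \<longrightarrow> \<bar>g $ j\<bar> \<le> \<bar>g $ i\<bar>)"

(* I T g plays the role of the index set I_T(g). Since several sets may qualify when magnitudes
   tie, a tie-breaking rule is represented by the choice function I it induces. *)
definition selection_rule :: "(nat \<Rightarrow> real ^ 'n \<Rightarrow> 'n set) \<Rightarrow> bool" where
  "selection_rule I \<longleftrightarrow> (\<forall>T\<in>{1..CARD('n)}. \<forall>g. largest_components T g (I T g))"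

lemma largest_components_exists:
  fixes g :: "real ^ 'n"
  assumes "T \<le> CARD('n)"
  shows "\<exists>S. largest_components T g S"
  using assms
proof (induction T)
  case 0
  show ?case by (rule exI[of _ "{}"]) (simp add: largest_components_def)
next
  case (Suc T)
  then obtain S where S: "card S = T"
    and le: "\<And>i j. i \<in> S \<Longrightarrow> j \<notin> S \<Longrightarrow> \<bar>g $ j\<bar> \<le> \<bar>g $ i\<bar>"
    by (auto simp: largest_components_def)
  have "- S \<noteq> {}"
  proof
    assume "- S = {}"
    then have "S = UNIV" by auto
    with Suc.prems S show False by simp
  qed
  then have "Max ((\<lambda>i. \<bar>g $ i\<bar>) ` (- S)) \<in> (\<lambda>i. \<bar>g $ i\<bar>) ` (- S)"
    by (intro Max_in) auto
  then obtain m where m: "m \<in> - S" "Max ((\<lambda>i. \<bar>g $ i\<bar>) ` (- S)) = \<bar>g $ m\<bar>"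
    by (rule imageE)
  have "\<bar>g $ j\<bar> \<le> \<bar>g $ m\<bar>" if "j \<notin> S" for j
    using that unfolding m(2)[symmetric] by (intro Max_ge) auto
  then have "largest_components (Suc T) g (insert m S)"
    using S le m(1) by (auto simp: largest_components_def)
  then show ?case by blast
qed

lemma selection_rule_exists: "\<exists>I :: nat \<Rightarrow> real ^ 'n \<Rightarrow> 'n set. selection_rule I"
  by (rule exI[of _ "\<lambda>T g. SOME S. largest_components T g S"])
     (simp add: selection_rule_def someI_ex[OF largest_components_exists])

definition sparse_quant ::
    "(nat \<Rightarrow> real ^ 'n \<Rightarrow> 'n set) \<Rightarrow> nat \<Rightarrow> real ^ 'n \<Rightarrow> real ^ 'n" where
  "sparse_quant I T g = (\<chi> j. if j \<in> I T g then norm g * sgn (g $ j) else 0)"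

definition beta ::
    "(nat \<Rightarrow> real ^ 'n \<Rightarrow> 'n set) \<Rightarrow> (real ^ 'n \<Rightarrow> real) \<Rightarrow> real ^ 'n \<Rightarrow> nat \<Rightarrow> real" where
  "beta I F x T =
     1 / real T * ((gradient F x \<bullet> sparse_quant I T (gradient F x))\<^sup>2 / norm (gradient F x) ^ 4)"

end

theory Submission
  imports Defs
begin

text \<open>
  Write \<open>g\<close> for the gradient at \<open>x\<close>, \<open>q\<close> for its compression and \<open>c = g \<bullet> q\<close>. A smooth function lies
  below the quadratic model given by its gradient (\<open>L_smooth_descent\<close>), so a step \<open>- \<gamma> q\<close> changes
  \<open>F\<close> by at most \<open>- \<gamma> c + L \<gamma>\<^sup>2 \<parallel>q\<parallel>\<^sup>2 / 2\<close>. Because \<open>q\<close> has at most \<open>T\<close> nonzero entries, each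
  of size \<open>\<parallel>g\<parallel>\<close>, we have \<open>\<parallel>q\<parallel>\<^sup>2 \<le> T \<parallel>g\<parallel>\<^sup>2\<close> (\<open>norm_sparse_quant_le\<close>). The resulting bound
  \<open>- \<gamma> c + L \<gamma>\<^sup>2 T \<parallel>g\<parallel>\<^sup>2 / 2\<close> is minimized over \<open>\<gamma>\<close> at \<open>c / (T L \<parallel>g\<parallel>\<^sup>2)\<close>, with minimum
  \<open>- c\<^sup>2 / (2 T L \<parallel>g\<parallel>\<^sup>2) = - \<beta> \<parallel>g\<parallel>\<^sup>2 / (2 L)\<close>. The prescribed step size is exactly this minimizer:
  \<open>sqrt \<beta> = \<bar>c\<bar> / (sqrt T \<parallel>g\<parallel>\<^sup>2)\<close>, and the absolute value can be dropped because \<open>q\<close> keeps the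
  signs of \<open>g\<close>, so that \<open>c \<ge> 0\<close> (\<open>inner_sparse_quant_nonneg\<close>).
\<close>

text \<open>
  Along the segment from \<open>x\<close> to \<open>x + h\<close>, the difference between \<open>F\<close> and its quadratic model has
  derivative \<open>(\<nabla>F(x + t h) - \<nabla>F(x)) \<bullet> h - L t \<parallel>h\<parallel>\<^sup>2\<close>. By Cauchy-Schwarz and the Lipschitz bound
  it is nonpositive for \<open>t \<ge> 0\<close>, so the difference decreases.
\<close>

lemma L_smooth_descent:
  fixes F :: "'a::euclidean_space \<Rightarrow> real"
  assumes "L_smooth L F"
  shows "F (x + h) \<le> F x + gradient F x \<bullet> h + L / 2 * (norm h)\<^sup>2"
proof -
  define gap where
    "gap t = F (x + t *\<^sub>R h) - t * (gradient F x \<bullet> h) - L / 2 * t\<^sup>2 * (norm h)\<^sup>2" for t :: real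
  define gap' where
    "gap' t = gradient F (x + t *\<^sub>R h) \<bullet> h - gradient F x \<bullet> h - L * t * (norm h)\<^sup>2" for t :: real
  have gap_deriv: "(gap has_real_derivative gap' t) (at t)" for t
  proof -
    have "GDERIV F (x + t *\<^sub>R h) :> gradient F (x + t *\<^sub>R h)"
      using assms by (intro gderiv_gradient) (simp add: L_smooth_def)
    then have "(F has_derivative (\<lambda>v. v \<bullet> gradient F (x + t *\<^sub>R h))) (at (x + t *\<^sub>R h))"
      by (simp add: gderiv_def)
    moreover have "((\<lambda>t. x + t *\<^sub>R h) has_derivative (\<lambda>s. s *\<^sub>R h)) (at t)"
      by (auto intro!: derivative_eq_intros)
    ultimately have "((\<lambda>t. F (x + t *\<^sub>R h)) has_derivative
        (\<lambda>s. (s *\<^sub>R h) \<bullet> gradient F (x + t *\<^sub>R h))) (at t)"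
      using has_derivative_compose by blast
    then have "((\<lambda>t. F (x + t *\<^sub>R h)) has_real_derivative gradient F (x + t *\<^sub>R h) \<bullet> h) (at t)"
      by (simp add: has_field_derivative_def inner_commute mult.commute[of _ "_ \<bullet> _"])
    then show ?thesis
      unfolding gap_def[abs_def] gap'_def
      by (auto intro!: derivative_eq_intros)
  qed
  have gap'_le_0: "gap' t \<le> 0" if "0 \<le> t" for t
  proof -
    have "gradient F (x + t *\<^sub>R h) \<bullet> h - gradient F x \<bullet> h
        = (gradient F (x + t *\<^sub>R h) - gradient F x) \<bullet> h"
      by (simp add: inner_diff_left)
    also have "\<dots> \<le> norm (gradient F (x + t *\<^sub>R h) - gradient F x) * norm h"
      by (rule norm_cauchy_schwarz)
    also have "\<dots> \<le> (L * norm (x + t *\<^sub>R h - x)) * norm h"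
      using assms unfolding L_smooth_def by (intro mult_right_mono norm_ge_zero) blast
    also have "\<dots> = L * t * (norm h)\<^sup>2"
      using that by (simp add: power2_eq_square)
    finally show ?thesis
      by (simp add: gap'_def)
  qed
  have "gap 1 \<le> gap 0"
    using gap_deriv gap'_le_0 by (intro DERIV_nonpos_imp_nonincreasing[of 0 1 gap]) auto
  then show ?thesis
    by (simp add: gap_def)
qed

lemma norm_sparse_quant_le:
  fixes g :: "real ^ 'n"
  assumes "card (I T g) = T"
  shows "(norm (sparse_quant I T g))\<^sup>2 \<le> real T * (norm g)\<^sup>2"
proof -
  have "(norm (sparse_quant I T g))\<^sup>2 = (\<Sum>j\<in>UNIV. (sparse_quant I T g $ j)\<^sup>2)"
    unfolding power2_norm_eq_inner by (simp add: inner_vec_def power2_eq_square)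
  also have "\<dots> \<le> (\<Sum>j\<in>UNIV. if j \<in> I T g then (norm g)\<^sup>2 else 0)"
    by (intro sum_mono) (simp add: sparse_quant_def sgn_if power_mult_distrib)
  also have "\<dots> = real T * (norm g)\<^sup>2"
    using assms by (simp add: sum.If_cases)
  finally show ?thesis .
qed

lemma inner_sparse_quant_nonneg:
  fixes g :: "real ^ 'n"
  shows "0 \<le> g \<bullet> sparse_quant I T g"
proof -
  have "g $ j * sparse_quant I T g $ j = (if j \<in> I T g then norm g * \<bar>g $ j\<bar> else 0)" for j
    by (simp add: sparse_quant_def abs_sgn)
  then show ?thesis
    by (simp add: inner_vec_def sum_nonneg)
qed

theorem lemma3:
  fixes F :: "real ^ 'n \<Rightarrow> real"
    and I :: "nat \<Rightarrow> real ^ 'n \<Rightarrow> 'n set"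
    and L \<gamma> :: real
    and T :: nat
    and x x_plus :: "real ^ 'n"
  assumes "L > 0"
    and "L_smooth L F"
    and "T \<in> {1..CARD('n)}"
    and "selection_rule I"
    and "gradient F x \<noteq> 0"
    and "\<gamma> = sqrt (beta I F x T) / (sqrt (real T) * L)"
    and "x_plus = x - \<gamma> *\<^sub>R sparse_quant I T (gradient F x)"
  shows "F x_plus \<le> F x - beta I F x T / (2 * L) * (norm (gradient F x))\<^sup>2"
proof -
  define g where "g = gradient F x"
  define q where "q = sparse_quant I T g"
  define c where "c = g \<bullet> q"
  define n where "n = (norm g)\<^sup>2"
  have T_pos: "real T > 0" and n_pos: "n > 0"
    using assms(3,5) by (auto simp: n_def g_def)
  have c_nonneg: "c \<ge> 0"
    unfolding c_def q_def by (rule inner_sparse_quant_nonneg)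
  have q_le: "(norm q)\<^sup>2 \<le> real T * n"
    unfolding q_def n_def using assms(3,4)
    by (intro norm_sparse_quant_le) (simp add: selection_rule_def largest_components_def)
  have beta_eq: "beta I F x T = c\<^sup>2 / (real T * n\<^sup>2)"
    by (simp add: beta_def c_def q_def n_def g_def flip: power_mult)
  have "sqrt (beta I F x T) = c / (sqrt (real T) * n)"
    using c_nonneg n_pos by (simp add: beta_eq real_sqrt_divide real_sqrt_mult)
  then have \<gamma>_eq: "\<gamma> = c / (real T * L * n)"
    using T_pos by (simp add: assms(6) mult.left_commute mult.commute)
  have "F x_plus = F (x + (- \<gamma>) *\<^sub>R q)"
    by (simp add: assms(7) q_def g_def)
  also have "\<dots> \<le> F x - \<gamma> * c + L / 2 * (\<gamma>\<^sup>2 * (norm q)\<^sup>2)"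
    using L_smooth_descent[OF assms(2), of x "(- \<gamma>) *\<^sub>R q"]
    by (simp add: c_def g_def power_mult_distrib)
  also have "\<dots> \<le> F x - \<gamma> * c + L / 2 * (\<gamma>\<^sup>2 * (real T * n))"
    using q_le assms(1) by (intro add_left_mono mult_left_mono) auto
  also have "\<dots> = F x - c\<^sup>2 / (2 * real T * L * n)"
    using T_pos n_pos assms(1) by (simp add: \<gamma>_eq field_simps power2_eq_square)
  also have "\<dots> = F x - beta I F x T / (2 * L) * (norm (gradient F x))\<^sup>2"
    using n_pos unfolding beta_eq g_def[symmetric] n_def[symmetric]
    by (simp add: field_simps power2_eq_square)
  finally show ?thesis .
qed

end
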